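(* Let $n\ge2$, let $(\mathfrak g,[\cdot,\cdots,\cdot],\alpha)$ be an $n$-ary multiplicative Hom-Nambu-Lie superalgebra over $\mathbb{K}$, and let $f_t=\sum_{p\ge0}f_pt^p$ and $f'_t=\sum_{p\ge0}f'_pt^p$ be two equivalent deformations of it. Then the infinitesimal deformations $f_1$ and $f'_1$ belong to the same cohomology class in the cohomology group $H^2(\mathfrak g,\mathfrak g)$.
   Context: All vector spaces are over a fixed field $\mathbb{K}$. For a $\mathbb{Z}_2$-graded vector space $\mathfrak g=\mathfrak g_{\bar 0}\oplus\mathfrak g_{\bar 1}$, $|x|\in\mathbb{Z}_2$ denotes the degree of a homogeneous element $x$; whenever $|x|$ appears, $x$ is assumed homogeneous. A (multi)linear map has degree $|f|$ if $|f(x_1,\cdots,x_m)|=|f|+|x_1|+\cdots+|x_m|$; it is even if $|f|=\bar0$. An $n$-ary multiplicative Hom-Nambu-Lie superalgebra is a triple $(\mathfrak g,[\cdot,\cdots,\cdot],\alpha)$ consisting of a $\mathbb{Z}_2$-graded vector space $\mathfrak g$, an $n$-linear map $[\cdot,\cdots,\cdot]:\mathfrak g\times\cdots\times\mathfrak g\to\mathfrak g$ and an even linear map $\alpha:\mathfrak g\to\mathfrak g$ such that, for all homogeneous elements: (1) $|[x_1,\cdots,x_n]|=|x_1|+\cdots+|x_n|$; (2) $[x_1,\cdots,x_i,x_{i+1},\cdots,x_n]=-(-1)^{|x_i||x_{i+1}|}[x_1,\cdots,x_{i+1},x_i,\cdots,x_n]$ for $1\le i\le n-1$; (3) $[\alpha(x_1),\cdots,\alpha(x_{n-1}),[y_1,\cdots,y_n]]=\sum_{i=1}^n(-1)^{(|x_1|+\cdots+|x_{n-1}|)(|y_1|+\cdots+|y_{i-1}|)}[\alpha(y_1),\cdots,\alpha(y_{i-1}),[x_1,\cdots,x_{n-1},y_i],\alpha(y_{i+1}),\cdots,\alpha(y_n)]$;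 (4) $\alpha[x_1,\cdots,x_n]=[\alpha(x_1),\cdots,\alpha(x_n)]$. Deformations. $\mathfrak g[[t]]$ is the $\mathbb{K}[[t]]$-module of formal power series with coefficients in $\mathfrak g$, and $\alpha$ is extended $\mathbb{K}[[t]]$-linearly. A deformation of $(\mathfrak g,[\cdot,\cdots,\cdot],\alpha)$ is a $\mathbb{K}[[t]]$-$n$-linear map $f_t=\sum_{p\ge0}f_pt^p:\mathfrak g[[t]]\times\cdots\times\mathfrak g[[t]]\to\mathfrak g[[t]]$, where each $f_p:\mathfrak g\times\cdots\times\mathfrak g\to\mathfrak g$ is $\mathbb{K}$-$n$-linear (extended $\mathbb{K}[[t]]$-linearly) and $f_0=[\cdot,\cdots,\cdot]$, such that $(\mathfrak g[[t]],f_t,\alpha)$ is an $n$-ary multiplicative Hom-Nambu-Lie superalgebra (i.e. satisfies (1)–(4) with $f_t$ as bracket). $f_1$ is called the infinitesimal deformation. Two deformations $f_t,f'_t$ are equivalent ($f_t\sim f'_t$) if there is an isomorphism $\Phi_t=\sum_{i\ge0}\varphi_it^i:(\mathfrak g[[t]],f_t,\alpha)\to(\mathfrak g[[t]],f'_t,\alpha)$, with $\varphi_i:\mathfrak g\to\mathfrak g$ even linear maps, $\varphi_0=\mathrm{id}_{\mathfrak g}$, $\varphi_i\circ\alpha=\alpha\circ\varphi_i$ for all $i$, and $\Phi_t\circ f_t(x_1,\cdots,x_n)=f'_t(\Phi_t(x_1),\cdots,\Phi_t(x_n))$. Cohomology. $C^1(\mathfrak g,\mathfrak g)$ is the $\mathbb{Z}_2$-graded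 space of linear maps $\varphi:\mathfrak g\to\mathfrak g$ with $\varphi\circ\alpha=\alpha\circ\varphi$. $C^2(\mathfrak g,\mathfrak g)$ is the $\mathbb{Z}_2$-graded space of $n$-linear maps $f:\mathfrak g\times\cdots\times\mathfrak g\to\mathfrak g$ that are super-skew-symmetric (i.e. satisfy the identity (2) with $f$ in place of the bracket) and satisfy $\alpha(f(x_1,\cdots,x_n))=f(\alpha(x_1),\cdots,\alpha(x_n))$. For homogeneous $\varphi\in C^1(\mathfrak g,\mathfrak g)$, $$\delta^1\varphi(x_1,\cdots,x_n)=-\varphi[x_1,\cdots,x_n]+\sum_{i=1}^n(-1)^{|\varphi|(|x_1|+\cdots+|x_{i-1}|)}[x_1,\cdots,\varphi(x_i),\cdots,x_n]\in C^2(\mathfrak g,\mathfrak g).$$ For homogeneous $f\in C^2(\mathfrak g,\mathfrak g)$, writing $|X|=|x_1|+\cdots+|x_{n-1}|$, $$\begin{aligned}\delta^2f(x_1,\cdots,x_{n-1},y_1,\cdots,y_n)=&\ f(\alpha(x_1),\cdots,\alpha(x_{n-1}),[y_1,\cdots,y_n])+(-1)^{|f||X|}[\alpha(x_1),\cdots,\alpha(x_{n-1}),f(y_1,\cdots,y_n)]\\&-\sum_{i=1}^n(-1)^{|X|(|y_1|+\cdots+|y_{i-1}|)}f(\alpha(y_1),\cdots,[x_1,\cdots,x_{n-1},y_i],\cdots,\alpha(y_n))\\&-\sum_{i=1}^n(-1)^{(|f|+|X|)(|y_1|+\cdots+|y_{i-1}|)}[\alpha(y_1),\cdots,f(x_1,\cdots,x_{n-1},y_i),\cdots,\alpha(y_n)].\end{aligned}$$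 Both are extended linearly. $Z^2(\mathfrak g,\mathfrak g)=\ker\delta^2$, $B^2(\mathfrak g,\mathfrak g)=\delta^1C^1(\mathfrak g,\mathfrak g)\subseteq Z^2(\mathfrak g,\mathfrak g)$ and $H^2(\mathfrak g,\mathfrak g)=Z^2(\mathfrak g,\mathfrak g)/B^2(\mathfrak g,\mathfrak g)$. *)

theory Defs
  imports "HOL-Library.Z2" "HOL-Computational_Algebra.Formal_Power_Series"
begin

unbundle fps_syntax

section \<open>Graded modules and multilinear maps\<close>

text \<open>
  Degrees live in \<^typ>\<open>bit\<close>, the field with two elements.  A grading of the module carried by
  the whole type \<open>'v\<close> is a map \<open>G\<close> from degrees to subsets; \<open>0\<close> is homogeneous of both degrees.
  The coefficients form a commutative ring because both \<open>\<K>\<close>-vector spaces and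
  \<open>\<K>[[t]]\<close>-modules are needed; over a field, \<^const>\<open>module\<close> is the library's \<^const>\<open>vector_space\<close>.
\<close>

locale graded_module = module scale
  for scale :: "'r::comm_ring_1 \<Rightarrow> 'v::ab_group_add \<Rightarrow> 'v" +
  fixes G :: "bit \<Rightarrow> 'v set"
  assumes subspace_G: "subspace (G d)"
    and G_spans: "\<exists>u\<in>G 0. \<exists>v\<in>G 1. x = u + v"
    and G_independent: "G 0 \<inter> G 1 = {0}"

definition hcomp :: "(bit \<Rightarrow> 'v::ab_group_add set) \<Rightarrow> bit \<Rightarrow> 'v \<Rightarrow> 'v" where
  "hcomp G d x = (THE u. u \<in> G d \<and> x - u \<in> G (d + 1))"

definition homog_list :: "(bit \<Rightarrow> 'v set) \<Rightarrow> bit list \<Rightarrow> 'v list \<Rightarrow> bool" where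
  "homog_list G ds xs \<longleftrightarrow> list_all2 (\<lambda>d x. x \<in> G d) ds xs"

text \<open>The operator \<open>x \<mapsto> (-1)\<^sup>d x\<close>.\<close>

definition koszul :: "bit \<Rightarrow> 'v::ab_group_add \<Rightarrow> 'v" where
  "koszul d x = (if d = 0 then x else - x)"

text \<open>
  An \<open>n\<close>-ary map is a function on lists, of which only the values on lists of length \<open>n\<close> matter.
  Requiring the value \<open>0\<close> on all other lists makes equality of functions coincide with equality of
  \<open>n\<close>-ary maps.
\<close>

definition nlinear ::
    "('r::comm_ring_1 \<Rightarrow> 'v::ab_group_add \<Rightarrow> 'v) \<Rightarrow> nat \<Rightarrow> ('v list \<Rightarrow> 'v) \<Rightarrow> bool" where
  "nlinear scale n f \<longleftrightarrow>
     (\<forall>xs i. length xs = n \<and> i < n \<longrightarrow> module_hom scale scale (\<lambda>x. f (xs[i := x]))) \<and>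
     (\<forall>xs. length xs \<noteq> n \<longrightarrow> f xs = 0)"

definition super_skew ::
    "(bit \<Rightarrow> 'v::ab_group_add set) \<Rightarrow> nat \<Rightarrow> ('v list \<Rightarrow> 'v) \<Rightarrow> bool" where
  "super_skew G n f \<longleftrightarrow>
     (\<forall>ds xs i. homog_list G ds xs \<and> length xs = n \<and> Suc i < n \<longrightarrow>
        f xs = - koszul (ds ! i * ds ! Suc i) (f (xs[i := xs ! Suc i, Suc i := xs ! i])))"


section \<open>Multiplicative Hom-Nambu-Lie superalgebras\<close>

text \<open>In list notation, \<open>[\<alpha>(y\<^sub>1),\<dots>,z,\<dots>,\<alpha>(y\<^sub>n)]\<close> with \<open>z\<close> in position \<open>i\<close> is
  \<open>br ((map \<alpha> ys)[i := z])\<close>; positions count from \<open>0\<close>, so that \<open>sum_list (take i es)\<close> is the sum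
  of the degrees of the arguments to the left of position \<open>i\<close>.\<close>

locale hom_nambu_lie_superalgebra = graded_module scale G
  for scale :: "'r::comm_ring_1 \<Rightarrow> 'v::ab_group_add \<Rightarrow> 'v"
    and G :: "bit \<Rightarrow> 'v set" +
  fixes n :: nat and br :: "'v list \<Rightarrow> 'v" and \<alpha> :: "'v \<Rightarrow> 'v"
  assumes bracket_nlinear: "nlinear scale n br"
    and \<alpha>_linear: "module_hom scale scale \<alpha>"
    and \<alpha>_even: "x \<in> G d \<Longrightarrow> \<alpha> x \<in> G d"
    and bracket_degree: "homog_list G ds xs \<Longrightarrow> length xs = n \<Longrightarrow> br xs \<in> G (sum_list ds)"
    and bracket_super_skew: "super_skew G n br"
    and hom_nambu_identity:
      "homog_list G ds xs \<Longrightarrow> homog_list G es ys \<Longrightarrow> Suc (length xs) = n \<Longrightarrow> length ys = n \<Longrightarrow>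
        br (map \<alpha> xs @ [br ys]) =
          (\<Sum>i<n. koszul (sum_list ds * sum_list (take i es))
                    (br ((map \<alpha> ys)[i := br (xs @ [ys ! i])])))"
    and multiplicative: "homog_list G ds xs \<Longrightarrow> length xs = n \<Longrightarrow> \<alpha> (br xs) = br (map \<alpha> xs)"

definition hom_nambu_lie_iso ::
    "('r::comm_ring_1 \<Rightarrow> 'v::ab_group_add \<Rightarrow> 'v) \<Rightarrow> (bit \<Rightarrow> 'v set) \<Rightarrow> nat \<Rightarrow> ('v list \<Rightarrow> 'v) \<Rightarrow> ('v \<Rightarrow> 'v) \<Rightarrow>
     ('r \<Rightarrow> 'w::ab_group_add \<Rightarrow> 'w) \<Rightarrow> (bit \<Rightarrow> 'w set) \<Rightarrow> ('w list \<Rightarrow> 'w) \<Rightarrow> ('w \<Rightarrow> 'w) \<Rightarrow>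
     ('v \<Rightarrow> 'w) \<Rightarrow> bool" where
  "hom_nambu_lie_iso scale G n br \<alpha> scale' G' br' \<alpha>' \<Phi> \<longleftrightarrow>
     module_hom scale scale' \<Phi> \<and> bij \<Phi> \<and> (\<forall>d. \<forall>x\<in>G d. \<Phi> x \<in> G' d) \<and>
     (\<forall>x. \<Phi> (\<alpha> x) = \<alpha>' (\<Phi> x)) \<and>
     (\<forall>xs. length xs = n \<longrightarrow> \<Phi> (br xs) = br' (map \<Phi> xs))"


section \<open>Formal deformations\<close>

text \<open>
  The \<open>\<K>[[t]]\<close>-module \<open>\<gg>[[t]]\<close> is the type \<open>'v fps\<close>, with the scalar multiplication
  \<open>fps_scale\<close> and the grading \<open>fps_grading\<close>.  A family of \<open>n\<close>-ary maps \<open>f\<^sub>p\<close> yields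
  \<open>f\<^sub>t = \<Sum>\<^sub>p f\<^sub>p t\<^sup>p\<close>, where
  \<open>f\<^sub>p (\<Sum>\<^sub>k x\<^sub>1\<^sub>,\<^sub>k t\<^sup>k, \<dots>, \<Sum>\<^sub>k x\<^sub>n\<^sub>,\<^sub>k t\<^sup>k)\<close> is expanded as a formal power series: the coefficient of
  \<open>t\<^sup>m\<close> in \<open>f\<^sub>t\<close> sums over \<open>p\<close> and exponents \<open>ks\<close> of total \<open>m\<close>.
\<close>

definition fps_scale :: "('k::comm_ring_1 \<Rightarrow> 'v::ab_group_add \<Rightarrow> 'v) \<Rightarrow> 'k fps \<Rightarrow> 'v fps \<Rightarrow> 'v fps" where
  "fps_scale scale c F = Abs_fps (\<lambda>m. \<Sum>i\<le>m. scale (c $ i) (F $ (m - i)))"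

definition fps_grading :: "(bit \<Rightarrow> 'v::zero set) \<Rightarrow> bit \<Rightarrow> 'v fps set" where
  "fps_grading G d = {F. \<forall>k. F $ k \<in> G d}"

definition fps_lift :: "('v::zero \<Rightarrow> 'v) \<Rightarrow> 'v fps \<Rightarrow> 'v fps" where
  "fps_lift \<alpha> F = Abs_fps (\<lambda>m. \<alpha> (F $ m))"

definition fps_map_series :: "(nat \<Rightarrow> 'v::comm_monoid_add \<Rightarrow> 'v) \<Rightarrow> 'v fps \<Rightarrow> 'v fps" where
  "fps_map_series \<phi> F = Abs_fps (\<lambda>m. \<Sum>i\<le>m. \<phi> i (F $ (m - i)))"

definition fps_nary_series :: "(nat \<Rightarrow> 'v::comm_monoid_add list \<Rightarrow> 'v) \<Rightarrow> 'v fps list \<Rightarrow> 'v fps" where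
  "fps_nary_series f Fs = Abs_fps (\<lambda>m. \<Sum>p\<le>m.
     \<Sum>ks | length ks = length Fs \<and> sum_list ks = m - p. f p (map2 fps_nth Fs ks))"

definition deformation ::
    "('k::field \<Rightarrow> 'v::ab_group_add \<Rightarrow> 'v) \<Rightarrow> (bit \<Rightarrow> 'v set) \<Rightarrow> nat \<Rightarrow> ('v list \<Rightarrow> 'v) \<Rightarrow> ('v \<Rightarrow> 'v) \<Rightarrow>
     (nat \<Rightarrow> 'v list \<Rightarrow> 'v) \<Rightarrow> bool" where
  "deformation scale G n br \<alpha> f \<longleftrightarrow>
     (\<forall>p. nlinear scale n (f p)) \<and> f 0 = br \<and>
     hom_nambu_lie_superalgebra (fps_scale scale) (fps_grading G) n (fps_nary_series f) (fps_lift \<alpha>)"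

definition equivalent_deformations ::
    "('k::field \<Rightarrow> 'v::ab_group_add \<Rightarrow> 'v) \<Rightarrow> (bit \<Rightarrow> 'v set) \<Rightarrow> nat \<Rightarrow> ('v \<Rightarrow> 'v) \<Rightarrow>
     (nat \<Rightarrow> 'v list \<Rightarrow> 'v) \<Rightarrow> (nat \<Rightarrow> 'v list \<Rightarrow> 'v) \<Rightarrow> bool" where
  "equivalent_deformations scale G n \<alpha> f f' \<longleftrightarrow>
     (\<exists>\<phi>. (\<forall>i. module_hom scale scale (\<phi> i) \<and> (\<forall>d. \<forall>x\<in>G d. \<phi> i x \<in> G d) \<and> \<phi> i \<circ> \<alpha> = \<alpha> \<circ> \<phi> i) \<and>
          \<phi> 0 = id \<and>
          hom_nambu_lie_iso
            (fps_scale scale) (fps_grading G) n (fps_nary_series f) (fps_lift \<alpha>)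
            (fps_scale scale) (fps_grading G) (fps_nary_series f') (fps_lift \<alpha>)
            (fps_map_series \<phi>))"


section \<open>Cohomology\<close>

definition C1 :: "('k::field \<Rightarrow> 'v::ab_group_add \<Rightarrow> 'v) \<Rightarrow> ('v \<Rightarrow> 'v) \<Rightarrow> ('v \<Rightarrow> 'v) set" where
  "C1 scale \<alpha> = {\<phi>. module_hom scale scale \<phi> \<and> \<phi> \<circ> \<alpha> = \<alpha> \<circ> \<phi>}"

definition C2 ::
    "('k::field \<Rightarrow> 'v::ab_group_add \<Rightarrow> 'v) \<Rightarrow> (bit \<Rightarrow> 'v set) \<Rightarrow> nat \<Rightarrow> ('v \<Rightarrow> 'v) \<Rightarrow> ('v list \<Rightarrow> 'v) set" where
  "C2 scale G n \<alpha> = {f. nlinear scale n f \<and> super_skew G n f \<and>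
     (\<forall>xs. length xs = n \<longrightarrow> \<alpha> (f xs) = f (map \<alpha> xs))}"

text \<open>The homogeneous components of degree \<open>d\<close> of linear and multilinear maps.\<close>

definition linear_comp ::
    "(bit \<Rightarrow> 'v::ab_group_add set) \<Rightarrow> bit \<Rightarrow> ('v \<Rightarrow> 'v) \<Rightarrow> 'v \<Rightarrow> 'v" where
  "linear_comp G d \<phi> x = (\<Sum>a\<in>{0,1}. hcomp G (d + a) (\<phi> (hcomp G a x)))"

definition nary_comp ::
    "(bit \<Rightarrow> 'v::ab_group_add set) \<Rightarrow> bit \<Rightarrow> ('v list \<Rightarrow> 'v) \<Rightarrow> 'v list \<Rightarrow> 'v" where
  "nary_comp G d f xs =
     (\<Sum>ds | length ds = length xs. hcomp G (d + sum_list ds) (f (map2 (hcomp G) ds xs)))"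

text \<open>
  \<open>delta1_homog\<close> and \<open>delta2_homog\<close> are the defining formulas of the coboundary operators for a
  cochain of degree \<open>d\<close> and arguments whose degrees are listed in \<open>ds\<close> and \<open>es\<close>.  The operators
  \<open>delta1\<close> and \<open>delta2\<close> extend them linearly in the cochain and in the arguments, by decomposing
  all of these into homogeneous components.
\<close>

definition delta1_homog ::
    "('v::ab_group_add list \<Rightarrow> 'v) \<Rightarrow> bit \<Rightarrow> ('v \<Rightarrow> 'v) \<Rightarrow> bit list \<Rightarrow> 'v list \<Rightarrow> 'v" where
  "delta1_homog br d \<phi> ds xs =
     - \<phi> (br xs) + (\<Sum>i<length xs. koszul (d * sum_list (take i ds)) (br (xs[i := \<phi> (xs ! i)])))"

definition delta1 ::
    "(bit \<Rightarrow> 'v::ab_group_add set) \<Rightarrow> ('v list \<Rightarrow> 'v) \<Rightarrow> ('v \<Rightarrow> 'v) \<Rightarrow> 'v list \<Rightarrow> 'v" where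
  "delta1 G br \<phi> xs =
     (\<Sum>d\<in>{0,1}. \<Sum>ds | length ds = length xs.
        delta1_homog br d (linear_comp G d \<phi>) ds (map2 (hcomp G) ds xs))"

definition delta2_homog ::
    "('v::ab_group_add list \<Rightarrow> 'v) \<Rightarrow> ('v \<Rightarrow> 'v) \<Rightarrow> bit \<Rightarrow> ('v list \<Rightarrow> 'v) \<Rightarrow>
     bit list \<Rightarrow> 'v list \<Rightarrow> bit list \<Rightarrow> 'v list \<Rightarrow> 'v" where
  "delta2_homog br \<alpha> d f ds xs es ys =
     f (map \<alpha> xs @ [br ys])
     + koszul (d * sum_list ds) (br (map \<alpha> xs @ [f ys]))
     - (\<Sum>i<length ys. koszul (sum_list ds * sum_list (take i es))
          (f ((map \<alpha> ys)[i := br (xs @ [ys ! i])])))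
     - (\<Sum>i<length ys. koszul ((d + sum_list ds) * sum_list (take i es))
          (br ((map \<alpha> ys)[i := f (xs @ [ys ! i])])))"

definition delta2 ::
    "(bit \<Rightarrow> 'v::ab_group_add set) \<Rightarrow> ('v list \<Rightarrow> 'v) \<Rightarrow> ('v \<Rightarrow> 'v) \<Rightarrow> ('v list \<Rightarrow> 'v) \<Rightarrow>
     'v list \<Rightarrow> 'v list \<Rightarrow> 'v" where
  "delta2 G br \<alpha> f xs ys =
     (\<Sum>d\<in>{0,1}. \<Sum>ds | length ds = length xs. \<Sum>es | length es = length ys.
        delta2_homog br \<alpha> d (nary_comp G d f)
          ds (map2 (hcomp G) ds xs) es (map2 (hcomp G) es ys))"

definition Z2 ::
    "('k::field \<Rightarrow> 'v::ab_group_add \<Rightarrow> 'v) \<Rightarrow> (bit \<Rightarrow> 'v set) \<Rightarrow> nat \<Rightarrow> ('v list \<Rightarrow> 'v) \<Rightarrow> ('v \<Rightarrow> 'v) \<Rightarrow>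
     ('v list \<Rightarrow> 'v) set" where
  "Z2 scale G n br \<alpha> = {f \<in> C2 scale G n \<alpha>.
     \<forall>xs ys. Suc (length xs) = n \<and> length ys = n \<longrightarrow> delta2 G br \<alpha> f xs ys = 0}"

definition B2 ::
    "('k::field \<Rightarrow> 'v::ab_group_add \<Rightarrow> 'v) \<Rightarrow> (bit \<Rightarrow> 'v set) \<Rightarrow> ('v list \<Rightarrow> 'v) \<Rightarrow> ('v \<Rightarrow> 'v) \<Rightarrow>
     ('v list \<Rightarrow> 'v) set" where
  "B2 scale G br \<alpha> = delta1 G br ` C1 scale \<alpha>"

definition cohomologous ::
    "('k::field \<Rightarrow> 'v::ab_group_add \<Rightarrow> 'v) \<Rightarrow> (bit \<Rightarrow> 'v set) \<Rightarrow> nat \<Rightarrow> ('v list \<Rightarrow> 'v) \<Rightarrow> ('v \<Rightarrow> 'v) \<Rightarrow>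
     (('v list \<Rightarrow> 'v) \<times> ('v list \<Rightarrow> 'v)) set" where
  "cohomologous scale G n br \<alpha> = {(f, h). f \<in> Z2 scale G n br \<alpha> \<and> h \<in> Z2 scale G n br \<alpha> \<and>
     (\<lambda>xs. f xs - h xs) \<in> B2 scale G br \<alpha>}"

definition H2 ::
    "('k::field \<Rightarrow> 'v::ab_group_add \<Rightarrow> 'v) \<Rightarrow> (bit \<Rightarrow> 'v set) \<Rightarrow> nat \<Rightarrow> ('v list \<Rightarrow> 'v) \<Rightarrow> ('v \<Rightarrow> 'v) \<Rightarrow>
     ('v list \<Rightarrow> 'v) set set" where
  "H2 scale G n br \<alpha> = Z2 scale G n br \<alpha> // cohomologous scale G n br \<alpha>"

end

theory Submission
  imports Defs
begin

text \<open>
  Comparing coefficients of \<open>t\<close>: the axioms for \<open>f\<^sub>t\<close>, evaluated on constant series, say that \<open>f\<^sub>1\<close>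
  is an even 2-cocycle, and the intertwining relation for \<open>\<Phi>\<^sub>t\<close> says
  \<open>f\<^sub>1 - f'\<^sub>1 = \<delta>\<^sup>1 \<phi>\<^sub>1\<close> with \<open>\<phi>\<^sub>1\<close> even.
\<close>

section \<open>Degrees and signs\<close>

lemma bit_UNIV_eq: "(UNIV :: bit set) = {0, 1}"
proof -
  have "x = 0 \<or> x = 1" for x :: bit
    by (cases x) auto
  then show ?thesis by auto
qed

lemma koszul_0 [simp]: "koszul 0 x = x"
  by (simp add: koszul_def)

lemma koszul_zero_right [simp]: "koszul d 0 = 0"
  by (simp add: koszul_def)

lemma koszul_add: "koszul d (x + y) = koszul d x + koszul d y"
  by (simp add: koszul_def)

lemma fps_koszul_nth: "koszul d F $ k = koszul d (F $ k)"
  by (simp add: koszul_def)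

section \<open>Multilinear maps and homogeneous components\<close>

lemma nlinear_wrong_length: "nlinear scale n f \<Longrightarrow> length xs \<noteq> n \<Longrightarrow> f xs = 0"
  by (simp add: nlinear_def)

lemma nlinear_slot:
  "nlinear scale n f \<Longrightarrow> length ps + Suc (length qs) = n \<Longrightarrow>
    module_hom scale scale (\<lambda>x. f (ps @ x # qs))"
  unfolding nlinear_def
  \<comment> \<open>The entry \<open>undefined\<close> is a placeholder: the update at position
    \<open>length ps\<close> overwrites it.\<close>
  by (drule conjunct1, drule spec[of _ "ps @ undefined # qs"], drule spec[of _ "length ps"]) simp

lemma nlinear_eq_0:
  assumes "nlinear scale n f" "0 \<in> set xs"
  shows "f xs = 0"
proof (cases "length xs = n")
  case True
  obtain ps qs where xs: "xs = ps @ 0 # qs"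
    using assms(2) by (meson split_list)
  then have "module_hom scale scale (\<lambda>x. f (ps @ x # qs))"
    using True by (intro nlinear_slot[OF assms(1)]) simp
  then show ?thesis unfolding xs by (rule module_hom.zero)
qed (simp add: nlinear_wrong_length[OF assms(1)])

lemma nlinear_diff:
  assumes "nlinear scale n f" "nlinear scale n g"
  shows "nlinear scale n (\<lambda>xs. f xs - g xs)"
  using assms unfolding nlinear_def
  by (auto simp: module_hom_iff module.scale_right_diff_distrib)

text \<open>Separates the degree of the first argument, so that sums over degree lists can be
  treated by induction on the argument list.\<close>

lemma sum_lists_length_Suc:
  fixes h :: "bit list \<Rightarrow> 'a::comm_monoid_add"
  shows "(\<Sum>ds | length ds = Suc k. h ds) = (\<Sum>d\<in>{0, 1}. \<Sum>ds | length ds = k. h (d # ds))"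
proof -
  have "(\<Sum>ds | length ds = Suc k. h ds) =
      (\<Sum>(d, ds)\<in>{0, 1} \<times> {ds. length ds = k}. h (d # ds))"
    by (rule sum.reindex_bij_witness[of _ "\<lambda>(d, ds). d # ds" "\<lambda>ds. (hd ds, tl ds)"])
      (auto simp: length_Suc_conv bit_UNIV_eq[symmetric])
  then show ?thesis by (simp add: sum.cartesian_product)
qed

section \<open>Projections to homogeneous components, and maps of degree 0\<close>

context graded_module
begin

lemma zero_in_G: "0 \<in> G d"
  using subspace_G subspace_0 by blast

text \<open>Justifies the definite description in \<open>hcomp\<close>. Two candidates differ by an
  element of both \<open>G d\<close> and \<open>G (d + 1)\<close>; these are \<open>G 0\<close> and
  \<open>G 1\<close> in some order, so the difference is 0.\<close>

lemma hcomp_ex1: "\<exists>!u. u \<in> G d \<and> x - u \<in> G (d + 1)"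
proof -
  obtain u v where uv: "u \<in> G 0" "v \<in> G 1" "x = u + v"
    using G_spans by blast
  have "\<exists>u. u \<in> G d \<and> x - u \<in> G (d + 1)"
  proof (cases d)
    case zero
    then show ?thesis using uv by (intro exI[of _ u]) auto
  next
    case one
    then show ?thesis using uv by (intro exI[of _ v]) auto
  qed
  moreover have "a = b"
    if "a \<in> G d \<and> x - a \<in> G (d + 1)" "b \<in> G d \<and> x - b \<in> G (d + 1)" for a b
  proof -
    have "a - b \<in> G d"
      using that subspace_G subspace_diff by blast
    moreover have "(x - b) - (x - a) \<in> G (d + 1)"
      using that subspace_G subspace_diff by blast
    then have "a - b \<in> G (d + 1)" by simp
    ultimately have "a - b \<in> G 0 \<inter> G 1"
      by (cases d) auto
    then show ?thesis using G_independent by simp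
  qed
  ultimately show ?thesis by blast
qed

lemma hcomp_in_G: "hcomp G d x \<in> G d"
  and hcomp_complement: "x - hcomp G d x \<in> G (d + 1)"
  using theI'[OF hcomp_ex1[of d x]] by (auto simp: hcomp_def)

lemma hcomp_eqI: "u \<in> G d \<Longrightarrow> x - u \<in> G (d + 1) \<Longrightarrow> hcomp G d x = u"
  using hcomp_ex1[of d x] hcomp_in_G[of d x] hcomp_complement[of x d] by blast

lemma hcomp_homog: "x \<in> G d \<Longrightarrow> hcomp G d x = x"
  by (rule hcomp_eqI) (auto simp: zero_in_G)

lemma hcomp_homog_other: "x \<in> G d \<Longrightarrow> hcomp G (1 + d) x = 0"
  by (rule hcomp_eqI) (cases d; simp add: zero_in_G)+

lemma hcomp_zero: "hcomp G d 0 = 0"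
  by (simp add: hcomp_homog zero_in_G)

lemma hcomp_sum: "hcomp G 0 x + hcomp G 1 x = x"
proof -
  have "hcomp G 1 x = x - hcomp G 0 x"
    by (rule hcomp_eqI) (use hcomp_in_G[of 0 x] hcomp_complement[of x 0] in auto)
  then show ?thesis by simp
qed

text \<open>An even map carries the decomposition of \<open>x\<close> to a decomposition of its
  image, and decompositions are unique. Used for \<alpha>.\<close>

lemma hcomp_even_commute:
  assumes "module_hom scale scale \<psi>" "\<And>d x. x \<in> G d \<Longrightarrow> \<psi> x \<in> G d"
  shows "hcomp G d (\<psi> x) = \<psi> (hcomp G d x)"
proof (rule hcomp_eqI)
  show "\<psi> (hcomp G d x) \<in> G d"
    using assms(2) hcomp_in_G by blast
  have "\<psi> x - \<psi> (hcomp G d x) = \<psi> (x - hcomp G d x)"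
    using module_hom.diff[OF assms(1)] by metis
  then show "\<psi> x - \<psi> (hcomp G d x) \<in> G (d + 1)"
    using assms(2) hcomp_complement by metis
qed

text \<open>Collapses the sum over cochain degrees in \<open>delta1\<close> for an even cochain:
  only the summand of degree 0 keeps its map.\<close>

lemma linear_comp_even:
  assumes "module_hom scale scale \<psi>" "\<And>d x. x \<in> G d \<Longrightarrow> \<psi> x \<in> G d"
  shows "linear_comp G 0 \<psi> = \<psi>" "linear_comp G 1 \<psi> = (\<lambda>_. 0)"
proof -
  have "\<psi> (hcomp G a x) \<in> G a" for a x
    using assms(2) hcomp_in_G by blast
  then have "hcomp G (0 + a) (\<psi> (hcomp G a x)) = \<psi> (hcomp G a x)"
      "hcomp G (1 + a) (\<psi> (hcomp G a x)) = 0" for a x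
    \<comment> \<open>Here and below degrees stay in the form \<open>1 + a\<close>; the default
      simpset would turn addition on \<open>bit\<close> into exclusive or.\<close>
    by (simp_all only: add_0 hcomp_homog hcomp_homog_other)
  then show "linear_comp G 0 \<psi> = \<psi>" "linear_comp G 1 \<psi> = (\<lambda>_. 0)"
    unfolding linear_comp_def fun_eq_iff
    by (simp_all add: module_hom.add[OF assms(1), symmetric] hcomp_sum del: add_bit_eq_xor)
qed

lemma homog_list_map2_hcomp:
  "length ds = length xs \<Longrightarrow> homog_list G ds (map2 (hcomp G) ds xs)"
  by (simp add: homog_list_def list_all2_conv_all_nth hcomp_in_G)

text \<open>The prefix \<open>ps\<close> makes the induction work: each step splits the first
  remaining argument by additivity in its slot and moves the component into the prefix.\<close>

lemma nlinear_expand_suffix: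
  assumes "nlinear scale n f"
  shows "length ps + length xs = n \<Longrightarrow>
    (\<Sum>ds | length ds = length xs. f (ps @ map2 (hcomp G) ds xs)) = f (ps @ xs)"
proof (induction xs arbitrary: ps)
  case Nil
  then show ?case by simp
next
  case (Cons x xs)
  have IH: "(\<Sum>ds | length ds = length xs. f (ps @ hcomp G d x # map2 (hcomp G) ds xs)) =
      f (ps @ hcomp G d x # xs)" for d
    using Cons.IH[of "ps @ [hcomp G d x]"] Cons.prems by simp
  have "module_hom scale scale (\<lambda>x. f (ps @ x # xs))"
    using Cons.prems by (intro nlinear_slot[OF assms]) simp
  from module_hom.add[OF this, of "hcomp G 0 x" "hcomp G 1 x"] show ?case
    by (simp add: sum_lists_length_Suc IH hcomp_sum)
qed

lemma nlinear_expand: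
  assumes "nlinear scale n f" "length xs = n"
  shows "(\<Sum>ds | length ds = length xs. f (map2 (hcomp G) ds xs)) = f xs"
  using nlinear_expand_suffix[OF assms(1), of "[]" xs] assms(2) by simp

text \<open>The counterpart of \<open>linear_comp_even\<close> for \<open>delta2\<close>. On lists
  of the wrong length both sides are 0 by the convention in \<open>nlinear\<close>.\<close>

lemma nary_comp_even:
  assumes f: "nlinear scale n f"
    and even: "\<And>ds xs. homog_list G ds xs \<Longrightarrow> length xs = n \<Longrightarrow> f xs \<in> G (sum_list ds)"
  shows "nary_comp G 0 f = f" "nary_comp G 1 f = (\<lambda>_. 0)"
proof -
  have *: "nary_comp G 0 f xs = f xs \<and> nary_comp G 1 f xs = 0" for xs
  proof (cases "length xs = n")
    case True
    have "f (map2 (hcomp G) ds xs) \<in> G (sum_list ds)" if "length ds = length xs" for ds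
      using that True by (intro even homog_list_map2_hcomp) auto
    then have "hcomp G (0 + sum_list ds) (f (map2 (hcomp G) ds xs)) = f (map2 (hcomp G) ds xs)"
        "hcomp G (1 + sum_list ds) (f (map2 (hcomp G) ds xs)) = 0" if "length ds = length xs" for ds
      using that by (simp_all only: add_0 hcomp_homog hcomp_homog_other)
    then show ?thesis
      using nlinear_expand[OF f True] by (simp add: nary_comp_def del: add_bit_eq_xor)
  next
    case False
    then show ?thesis
      by (simp add: nary_comp_def nlinear_wrong_length[OF f] hcomp_zero)
  qed
  then show "nary_comp G 0 f = f" "nary_comp G 1 f = (\<lambda>_. 0)" by auto
qed

end

section \<open>Low-order coefficients of multilinear power series\<close>

lemma lists_sum_0:
  "{ks :: nat list. length ks = N \<and> sum_list ks = 0} = {replicate N 0}"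
  by (auto simp: sum_list_eq_0_iff intro!: replicate_eqI)

text \<open>Natural numbers with sum 1 consist of a single 1 and zeros elsewhere, so these exponent
  lists are the unit vectors.\<close>

lemma lists_sum_1:
  "{ks :: nat list. length ks = N \<and> sum_list ks = 1} = (\<lambda>i. (replicate N 0)[i := 1]) ` {..<N}"
proof (intro equalityI subsetI)
  fix ks :: "nat list" assume "ks \<in> {ks. length ks = N \<and> sum_list ks = 1}"
  then have len: "length ks = N" and "(\<Sum>i\<in>{0..<N}. ks ! i) = 1"
    by (auto simp: sum_list_sum_nth)
  then obtain i where i: "i < N" "ks ! i = 1" "\<forall>j<N. i \<noteq> j \<longrightarrow> ks ! j = 0"
    by (subst (asm) sum_eq_1_iff) auto
  then have "ks = (replicate N 0)[i := 1]"
    using len by (intro nth_equalityI) (auto simp: nth_list_update)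
  then show "ks \<in> (\<lambda>i. (replicate N 0)[i := 1]) ` {..<N}"
    using i by auto
qed (auto simp: sum_list_update)

lemma fps_nary_series_nth_0: "fps_nary_series f Fs $ 0 = f 0 (map (\<lambda>F. F $ 0) Fs)"
proof -
  have "map2 fps_nth Fs (replicate (length Fs) 0) = map (\<lambda>F. F $ 0) Fs"
    by (intro nth_equalityI) auto
  then show ?thesis
    by (simp add: fps_nary_series_def lists_sum_0 del: sum_list_eq_0_iff)
qed

text \<open>The single power of t comes either from \<open>f 1\<close>, all arguments giving their
  constant term, or from exactly one argument of \<open>f 0\<close>.\<close>

lemma fps_nary_series_nth_1:
  "fps_nary_series f Fs $ 1 = f 1 (map (\<lambda>F. F $ 0) Fs) +
     (\<Sum>i<length Fs. f 0 ((map (\<lambda>F. F $ 0) Fs)[i := (Fs ! i) $ 1]))"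
proof -
  let ?N = "length Fs"
  have 0: "map2 fps_nth Fs (replicate ?N 0) = map (\<lambda>F. F $ 0) Fs"
    by (intro nth_equalityI) auto
  have 1: "map2 fps_nth Fs ((replicate ?N 0)[i := 1]) = (map (\<lambda>F. F $ 0) Fs)[i := (Fs ! i) $ 1]"
    if "i < ?N" for i
    using that by (intro nth_equalityI) (auto simp: nth_list_update)
  have inj: "inj_on (\<lambda>i. (replicate ?N 0)[i := 1::nat]) {..<?N}"
  proof (rule inj_onI)
    fix i j assume ij: "i \<in> {..<?N}" "j \<in> {..<?N}"
      "(replicate ?N 0)[i := 1::nat] = (replicate ?N 0)[j := 1]"
    then have "(replicate ?N 0)[i := 1::nat] ! i = (replicate ?N 0)[j := 1] ! i" by metis
    then show "i = j" using ij(1,2) by (auto simp: nth_list_update split: if_splits)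
  qed
  have "fps_nary_series f Fs $ 1 =
      (\<Sum>ks | length ks = ?N \<and> sum_list ks = 1. f 0 (map2 fps_nth Fs ks)) +
      (\<Sum>ks | length ks = ?N \<and> sum_list ks = 0. f 1 (map2 fps_nth Fs ks))"
    by (simp add: fps_nary_series_def atMost_Suc add.commute)
  also have "\<dots> = (\<Sum>i<?N. f 0 ((map (\<lambda>F. F $ 0) Fs)[i := (Fs ! i) $ 1])) +
      f 1 (map (\<lambda>F. F $ 0) Fs)"
    unfolding lists_sum_0 lists_sum_1 sum.reindex[OF inj] using 0 1 by simp
  finally show ?thesis by (simp add: add.commute)
qed

text \<open>A constant series has linear coefficient 0, so every term with \<open>f 0\<close> has a
  zero argument and vanishes.\<close>

lemma fps_nary_series_const_nth_1:
  assumes "nlinear scale n (f 0)"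
  shows "fps_nary_series f (map fps_const xs) $ 1 = f 1 xs"
proof -
  have "f 0 (xs[i := 0]) = 0" if "i < length xs" for i
    using that by (intro nlinear_eq_0[OF assms]) (simp add: set_update_memI)
  then show ?thesis
    by (subst fps_nary_series_nth_1) (simp add: o_def)
qed

lemma fps_nary_series_const_nth_0: "fps_nary_series f (map fps_const xs) $ 0 = f 0 xs"
  by (simp add: fps_nary_series_nth_0 o_def)

text \<open>Prepared for nested brackets: \<open>F\<close> will be the inner bracket, the only
  argument that is not a constant series.\<close>

lemma fps_nary_series_one_slot:
  assumes "nlinear scale n (f 0)" "j < length xs"
  shows "fps_nary_series f ((map fps_const xs)[j := F]) $ 1 =
    f 1 (xs[j := F $ 0]) + f 0 (xs[j := F $ 1])"
proof -
  let ?Fs = "(map fps_const xs)[j := F]"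
  have base: "map (\<lambda>F. F $ 0) ?Fs = xs[j := F $ 0]"
    by (simp add: map_update o_def)
  have "(\<Sum>i<length ?Fs. f 0 ((map (\<lambda>F. F $ 0) ?Fs)[i := (?Fs ! i) $ 1])) =
      (\<Sum>i<length xs. if i = j then f 0 (xs[j := F $ 1]) else 0)"
  proof (rule sum.cong)
    fix i assume "i \<in> {..<length xs}"
    then have i: "i < length xs" by simp
    show "f 0 ((map (\<lambda>F. F $ 0) ?Fs)[i := (?Fs ! i) $ 1]) =
        (if i = j then f 0 (xs[j := F $ 1]) else 0)"
    proof (cases "i = j")
      case True
      then show ?thesis using i unfolding base by simp
    next
      case False
      then show ?thesis using i unfolding base
        by (simp add: nlinear_eq_0[OF assms(1)] set_update_memI)
    qed
  qed simp
  then show ?thesis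
    using assms(2) by (subst fps_nary_series_nth_1) (simp add: base)
qed

lemma fps_lift_const: "\<alpha> 0 = 0 \<Longrightarrow> fps_lift \<alpha> (fps_const x) = fps_const (\<alpha> x)"
  by (simp add: fps_lift_def fps_eq_iff)

lemma (in graded_module) homog_list_const:
  "homog_list G ds xs \<Longrightarrow> homog_list (fps_grading G) ds (map fps_const xs)"
  by (auto simp: homog_list_def list_all2_conv_all_nth fps_grading_def zero_in_G)

section \<open>The infinitesimal of a deformation\<close>

locale hom_nambu_lie_deformation = hom_nambu_lie_superalgebra scale G n br \<alpha>
  for scale :: "'k::field \<Rightarrow> 'v::ab_group_add \<Rightarrow> 'v" and G n br \<alpha> +
  fixes f :: "nat \<Rightarrow> 'v list \<Rightarrow> 'v"
  assumes deformation: "deformation scale G n br \<alpha> f"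
begin

lemma coeff_nlinear: "nlinear scale n (f p)" and coeff_0: "f 0 = br"
  using deformation by (auto simp: deformation_def)

sublocale series: hom_nambu_lie_superalgebra
  "fps_scale scale" "fps_grading G" n "fps_nary_series f" "fps_lift \<alpha>"
  using deformation by (simp add: deformation_def)

lemma \<alpha>_0: "\<alpha> 0 = 0"
  using module_hom.zero[OF \<alpha>_linear] .

text \<open>The degree axiom for the series bracket bounds every coefficient, in particular that of
  t. This evenness reduces \<open>delta2\<close> of \<open>f 1\<close> to its formula in degree
  0.\<close>

lemma infinitesimal_even:
  assumes "homog_list G ds xs" "length xs = n"
  shows "f 1 xs \<in> G (sum_list ds)"
proof -
  have "fps_nary_series f (map fps_const xs) \<in> fps_grading G (sum_list ds)"
    using assms by (intro series.bracket_degree homog_list_const) auto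
  then show ?thesis
    using fps_nary_series_const_nth_1[of scale n f xs, OF coeff_nlinear]
    by (auto simp: fps_grading_def dest: spec[of _ 1])
qed

lemma infinitesimal_super_skew: "super_skew G n (f 1)"
  unfolding super_skew_def
proof (intro allI impI, elim conjE)
  fix ds :: "bit list" and xs i
  assume xs: "homog_list G ds xs" "length xs = n" "Suc i < n"
  have "fps_nary_series f (map fps_const xs) = - koszul (ds ! i * ds ! Suc i)
      (fps_nary_series f ((map fps_const xs)[i := map fps_const xs ! Suc i,
        Suc i := map fps_const xs ! i]))"
    using series.bracket_super_skew homog_list_const[OF xs(1)] xs(2,3)
    unfolding super_skew_def by simp
  also have "(map fps_const xs)[i := map fps_const xs ! Suc i, Suc i := map fps_const xs ! i] =
      map fps_const (xs[i := xs ! Suc i, Suc i := xs ! i])"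
    using xs by (simp add: map_update)
  finally show "f 1 xs = - koszul (ds ! i * ds ! Suc i) (f 1 (xs[i := xs ! Suc i, Suc i := xs ! i]))"
    by (metis fps_nary_series_const_nth_1[of scale n f, OF coeff_nlinear] fps_neg_nth fps_koszul_nth)
qed

text \<open>The axiom covers homogeneous arguments, whereas \<open>C2\<close> asks for all
  arguments. Expanding into components bridges the gap, since \<alpha> is even and commutes with the
  projections.\<close>

lemma infinitesimal_multiplicative:
  assumes "length xs = n"
  shows "\<alpha> (f 1 xs) = f 1 (map \<alpha> xs)"
proof -
  have homog: "\<alpha> (f 1 ys) = f 1 (map \<alpha> ys)" if "homog_list G ds ys" "length ys = n" for ds ys
  proof -
    have "fps_lift \<alpha> (fps_nary_series f (map fps_const ys)) =
        fps_nary_series f (map (fps_lift \<alpha>) (map fps_const ys))"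
      using that by (intro series.multiplicative homog_list_const) auto
    also have "map (fps_lift \<alpha>) (map fps_const ys) = map fps_const (map \<alpha> ys)"
      by (simp add: fps_lift_const[of \<alpha>, OF \<alpha>_0])
    finally have "fps_lift \<alpha> (fps_nary_series f (map fps_const ys)) $ 1 =
        fps_nary_series f (map fps_const (map \<alpha> ys)) $ 1" by simp
    then show ?thesis
      unfolding fps_nary_series_const_nth_1[of scale n f, OF coeff_nlinear]
      unfolding fps_lift_def fps_nth_Abs_fps fps_nary_series_const_nth_1[of scale n f, OF coeff_nlinear] .
  qed
  have "\<alpha> (f 1 xs) = \<alpha> (\<Sum>ds | length ds = length xs. f 1 (map2 (hcomp G) ds xs))"
    by (simp only: nlinear_expand[OF coeff_nlinear assms])
  also have "\<dots> = (\<Sum>ds | length ds = length xs. \<alpha> (f 1 (map2 (hcomp G) ds xs)))"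
    by (rule module_hom.sum[OF \<alpha>_linear])
  also have "\<dots> = (\<Sum>ds | length ds = length (map \<alpha> xs). f 1 (map2 (hcomp G) ds (map \<alpha> xs)))"
  proof (rule sum.cong)
    fix ds :: "bit list" assume "ds \<in> {ds. length ds = length (map \<alpha> xs)}"
    then have len: "length ds = length xs" by simp
    have "map \<alpha> (map2 (hcomp G) ds xs) = map2 (hcomp G) ds (map \<alpha> xs)"
      using len
      by (intro nth_equalityI) (auto simp: hcomp_even_commute[OF \<alpha>_linear \<alpha>_even])
    then show "\<alpha> (f 1 (map2 (hcomp G) ds xs)) = f 1 (map2 (hcomp G) ds (map \<alpha> xs))"
      using homog[OF homog_list_map2_hcomp[OF len]] len assms by simp
  qed simp
  also have "\<dots> = f 1 (map \<alpha> xs)"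
    using assms by (intro nlinear_expand[OF coeff_nlinear]) simp
  finally show ?thesis .
qed

lemma infinitesimal_in_C2: "f 1 \<in> C2 scale G n \<alpha>"
  by (simp add: C2_def coeff_nlinear infinitesimal_super_skew infinitesimal_multiplicative
      del: One_nat_def)

text \<open>The coefficient of t in the Hom-Nambu identity for constant series. On either side the
  index 1 falls on the outer or on the inner bracket, which yields the four terms of
  \<open>delta2_homog\<close>.\<close>

lemma infinitesimal_delta2_homog:
  assumes xs: "homog_list G ds xs" "Suc (length xs) = n"
    and ys: "homog_list G es ys" "length ys = n"
  shows "delta2_homog br \<alpha> 0 (f 1) ds xs es ys = 0"
proof -
  note const_1 = fps_nary_series_const_nth_1[of scale n f, OF coeff_nlinear]
    and const_0 = fps_nary_series_const_nth_0[of f, unfolded coeff_0]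
    and slot = fps_nary_series_one_slot[of scale n f, OF coeff_nlinear, unfolded coeff_0]
  have \<alpha>_const: "map (fps_lift \<alpha>) (map fps_const zs) = map fps_const (map \<alpha> zs)" for zs
    by (simp add: fps_lift_const[of \<alpha>, OF \<alpha>_0])
  have "fps_nary_series f (map (fps_lift \<alpha>) (map fps_const xs) @
        [fps_nary_series f (map fps_const ys)]) =
      (\<Sum>i<n. koszul (sum_list ds * sum_list (take i es))
        (fps_nary_series f ((map (fps_lift \<alpha>) (map fps_const ys))
          [i := fps_nary_series f (map fps_const xs @ [map fps_const ys ! i])])))"
    using xs ys by (intro series.hom_nambu_identity homog_list_const) auto
  then have eq: "fps_nary_series f (map fps_const (map \<alpha> xs) @
        [fps_nary_series f (map fps_const ys)]) $ 1 =
      (\<Sum>i<n. koszul (sum_list ds * sum_list (take i es))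
        (fps_nary_series f ((map fps_const (map \<alpha> ys))
          [i := fps_nary_series f (map fps_const xs @ [map fps_const ys ! i])]) $ 1))"
    unfolding \<alpha>_const by (simp only: fps_sum_nth fps_koszul_nth)
  \<comment> \<open>The last entry 0 is a dummy; writing the list as an update brings it into the
    form of \<open>fps_nary_series_one_slot\<close>.\<close>
  have "map fps_const (map \<alpha> xs) @ [F] = (map fps_const (map \<alpha> xs @ [0]))[length xs := F]" for F
    by (simp add: list_update_append)
  then have lhs: "fps_nary_series f (map fps_const (map \<alpha> xs) @
        [fps_nary_series f (map fps_const ys)]) $ 1 =
      f 1 (map \<alpha> xs @ [br ys]) + br (map \<alpha> xs @ [f 1 ys])"
    by (simp only:) (subst slot, simp_all only: const_0 const_1, simp_all add: list_update_append)
  have rhs: "fps_nary_series f ((map fps_const (map \<alpha> ys))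
        [i := fps_nary_series f (map fps_const xs @ [map fps_const ys ! i])]) $ 1 =
      f 1 ((map \<alpha> ys)[i := br (xs @ [ys ! i])]) + br ((map \<alpha> ys)[i := f 1 (xs @ [ys ! i])])"
    if "i < n" for i
  proof -
    have "map fps_const xs @ [map fps_const ys ! i] = map fps_const (xs @ [ys ! i])"
      using that ys by simp
    then show ?thesis
      using that ys by (simp only:) (subst slot, simp_all only: const_0 const_1, simp_all)
  qed
  show ?thesis
  proof -
    have "f 1 (map \<alpha> xs @ [br ys]) + br (map \<alpha> xs @ [f 1 ys]) =
        (\<Sum>i<n. koszul (sum_list ds * sum_list (take i es))
          (f 1 ((map \<alpha> ys)[i := br (xs @ [ys ! i])]) + br ((map \<alpha> ys)[i := f 1 (xs @ [ys ! i])])))"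
      unfolding eq[unfolded lhs] by (rule sum.cong) (simp_all only: rhs lessThan_iff)
    \<comment> \<open>For a cochain of degree 0 both sums in \<open>delta2_homog\<close> carry the
      same signs and the bracket term carries none, so the right-hand side splits into exactly these
      sums.\<close>
    then show ?thesis
      by (simp add: delta2_homog_def ys(2) koszul_add sum.distrib del: One_nat_def)
  qed
qed

lemma infinitesimal_in_Z2: "f 1 \<in> Z2 scale G n br \<alpha>"
proof -
  note comp = nary_comp_even[OF coeff_nlinear infinitesimal_even]
  have "delta2 G br \<alpha> (f 1) xs ys = 0" if len: "Suc (length xs) = n" "length ys = n" for xs ys
  proof -
    have "delta2_homog br \<alpha> 0 (f 1) ds (map2 (hcomp G) ds xs) es (map2 (hcomp G) es ys) = 0"
      if "length ds = length xs" "length es = length ys" for ds es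
      using that len by (intro infinitesimal_delta2_homog homog_list_map2_hcomp) auto
    \<comment> \<open>The odd component of \<open>f 1\<close> is the zero map, and a bracket with a
      zero argument vanishes.\<close>
    moreover have "delta2_homog br \<alpha> 1 (\<lambda>_. 0) ds us es vs = 0"
      for ds us es and vs :: "'v list"
      by (simp add: delta2_homog_def nlinear_eq_0[OF bracket_nlinear] set_update_memI)
    ultimately show ?thesis
      by (simp add: delta2_def comp del: One_nat_def)
  qed
  then show ?thesis
    using infinitesimal_in_C2 by (simp add: Z2_def)
qed

end

section \<open>Comparison of the two infinitesimals\<close>

theorem theorem3p5:
  fixes scale :: "'k::field \<Rightarrow> 'v::ab_group_add \<Rightarrow> 'v"
    and G :: "bit \<Rightarrow> 'v set" and n :: nat
    and br :: "'v list \<Rightarrow> 'v" and \<alpha> :: "'v \<Rightarrow> 'v"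
    and f f' :: "nat \<Rightarrow> 'v list \<Rightarrow> 'v"
  assumes "2 \<le> n"
    and "hom_nambu_lie_superalgebra scale G n br \<alpha>"
    and "deformation scale G n br \<alpha> f"
    and "deformation scale G n br \<alpha> f'"
    and "equivalent_deformations scale G n \<alpha> f f'"
  shows "\<exists>c \<in> H2 scale G n br \<alpha>. f 1 \<in> c \<and> f' 1 \<in> c"
proof -
  interpret D: hom_nambu_lie_deformation scale G n br \<alpha> f
    using assms by (simp add: hom_nambu_lie_deformation_def hom_nambu_lie_deformation_axioms_def)
  interpret D': hom_nambu_lie_deformation scale G n br \<alpha> f'
    using assms by (simp add: hom_nambu_lie_deformation_def hom_nambu_lie_deformation_axioms_def)
  obtain \<phi> where hom: "\<And>i. module_hom scale scale (\<phi> i)"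
    and even: "\<And>i d x. x \<in> G d \<Longrightarrow> \<phi> i x \<in> G d"
    and comm: "\<And>i. \<phi> i \<circ> \<alpha> = \<alpha> \<circ> \<phi> i" and \<phi>0: "\<phi> 0 = id"
    and iso: "\<And>Fs. length Fs = n \<Longrightarrow> fps_map_series \<phi> (fps_nary_series f Fs) =
        fps_nary_series f' (map (fps_map_series \<phi>) Fs)"
    using assms(5) unfolding equivalent_deformations_def hom_nambu_lie_iso_def by blast
  \<comment> \<open>The coefficient of t in the intertwining relation on constant series. The list
    \<open>ds\<close> is arbitrary because the degree 0 of the cochain makes every sign
    trivial.\<close>
  have delta1_homog: "delta1_homog br 0 (\<phi> 1) ds xs = f 1 xs - f' 1 xs"
    if "length xs = n" for ds xs
  proof -
    let ?Fs = "map fps_const xs" and ?\<Phi> = "fps_map_series \<phi>"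
    have nth_0: "?\<Phi> F $ 0 = F $ 0" and nth_1: "?\<Phi> F $ 1 = F $ 1 + \<phi> 1 (F $ 0)" for F
      by (simp_all add: fps_map_series_def atMost_Suc \<phi>0)
    have "?\<Phi> (fps_nary_series f ?Fs) $ 1 = fps_nary_series f' (map ?\<Phi> ?Fs) $ 1"
      using iso[of ?Fs] that by simp
    also have "?\<Phi> (fps_nary_series f ?Fs) $ 1 = f 1 xs + \<phi> 1 (br xs)"
      by (simp only: nth_1 fps_nary_series_const_nth_1[of scale n f, OF D.coeff_nlinear]
          fps_nary_series_const_nth_0 D.coeff_0)
    \<comment> \<open>The image of a constant series has constant term \<open>x\<close> and linear
      coefficient \<open>\<phi> 1 x\<close>, and \<open>f' 0\<close> is the original
      bracket.\<close>
    also have "fps_nary_series f' (map ?\<Phi> ?Fs) $ 1 =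
        f' 1 xs + (\<Sum>i<length xs. br (xs[i := \<phi> 1 (xs ! i)]))"
      by (subst fps_nary_series_nth_1)
        (simp add: o_def nth_0 nth_1[simplified] D'.coeff_0)
    finally show ?thesis
      by (simp add: delta1_homog_def algebra_simps)
  qed
  note comp = D.linear_comp_even[OF hom[of 1] even[of _ _ 1]]
  have zero_left: "delta1_homog br d (\<lambda>_. 0) ds xs = 0" for d ds xs
    by (simp add: delta1_homog_def nlinear_eq_0[OF D.bracket_nlinear] set_update_memI)
  note diff_nlinear = nlinear_diff[OF D.coeff_nlinear[of 1] D'.coeff_nlinear[of 1]]
  \<comment> \<open>Membership in \<open>B2\<close> is an equality of functions on all lists, so
    lists of the wrong length count too; there both sides have the default value 0.\<close>
  have "delta1 G br (\<phi> 1) xs = f 1 xs - f' 1 xs" for xs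
  proof (cases "length xs = n")
    case True
    have "delta1 G br (\<phi> 1) xs = (\<Sum>ds | length ds = length xs.
        f 1 (map2 (hcomp G) ds xs) - f' 1 (map2 (hcomp G) ds xs))"
      using True by (simp add: delta1_def comp zero_left delta1_homog del: One_nat_def)
    then show ?thesis
      using D.nlinear_expand[OF diff_nlinear True] by simp
  next
    case False
    have "delta1_homog br 0 (\<phi> 1) ds ys = 0" if "length ys \<noteq> n" for ds ys
      using that by (simp add: delta1_homog_def nlinear_wrong_length[OF D.bracket_nlinear]
          module_hom.zero[OF hom])
    then show ?thesis
      using False by (simp add: delta1_def comp zero_left nlinear_wrong_length[OF diff_nlinear]
          del: One_nat_def)
  qed
  moreover have "\<phi> 1 \<in> C1 scale \<alpha>"
    using hom comm by (simp add: C1_def)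
  ultimately have "(\<lambda>xs. f 1 xs - f' 1 xs) \<in> B2 scale G br \<alpha>"
    unfolding B2_def by (intro image_eqI[of _ _ "\<phi> 1"]) auto
  \<comment> \<open>The class will be the image of \<open>f 1\<close> under
    \<open>cohomologous\<close>. That \<open>f 1\<close> lies in it requires the zero cochain to be
    a coboundary, namely that of the zero map.\<close>
  moreover have "(\<lambda>xs. f 1 xs - f 1 xs) \<in> B2 scale G br \<alpha>"
    unfolding B2_def
  proof (rule image_eqI)
    have zero: "module_hom scale scale (\<lambda>_. 0)"
      by (simp add: module_hom_iff D.module_axioms)
    then show "(\<lambda>_. 0) \<in> C1 scale \<alpha>"
      by (simp add: C1_def o_def D.\<alpha>_0)
    have "linear_comp G d (\<lambda>_. 0) = (\<lambda>_. 0)" for d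
      by (simp add: linear_comp_def D.hcomp_zero fun_eq_iff)
    then show "(\<lambda>xs. f 1 xs - f 1 xs) = delta1 G br (\<lambda>_. 0)"
      by (intro ext) (simp add: delta1_def zero_left)
  qed
  ultimately have "f 1 \<in> cohomologous scale G n br \<alpha> `` {f 1}"
      "f' 1 \<in> cohomologous scale G n br \<alpha> `` {f 1}"
    using D.infinitesimal_in_Z2 D'.infinitesimal_in_Z2 by (auto simp: cohomologous_def)
  then show ?thesis
    unfolding H2_def using quotientI[OF D.infinitesimal_in_Z2] by blast
qed

end
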